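(* Let $n\geq 2$ and $M\geq 1$ be integers, and let $\{X_t\}_{t=0,1,2,\ldots}$ be the $n$-urn Ehrenfest chain with $M$ balls on $\{1,\ldots,n\}^M$. Then $$\mathbb{E}\bigl(T_{(2,2,\ldots,2)}\,\big|\,X_0=(1,1,\ldots,1)\bigr)=\frac{(n-1)M}{n}\sum_{k=1}^M\frac{n^k}{k},$$ where $(1,1,\ldots,1)$ and $(2,2,\ldots,2)$ denote the configurations in $\{1,\ldots,n\}^M$ with all $M$ coordinates equal to $1$, respectively $2$.
   Context: The $n$-urn Ehrenfest chain with $M$ balls is the time-homogeneous Markov chain $X_t=(X_t^{(1)},\ldots,X_t^{(M)})$, $t=0,1,2,\ldots$, on $\{1,\ldots,n\}^M$ ($X_t^{(i)}$ is the label of the urn containing ball $i$ at time $t$) with transition probabilities $p_{x,y}=\frac{1}{(n-1)M}$ if $x=(x_1,\ldots,x_M)$ and $y=(y_1,\ldots,y_M)$ differ in exactly one coordinate, and $p_{x,y}=0$ otherwise. That is, at each step a uniformly random ball is moved to a uniformly random one of the other $n-1$ urns. For $x\in\{1,\ldots,n\}^M$, $T_x=\inf\{t\geq 0: X_t=x\}$ is the hitting time of $x$. *)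

theory Defs
  imports "HOL-Probability.Probability"
begin

text \<open>Time-homogeneous Markov chain with countable state space \<open>S\<close>, transition probabilities
  \<open>p\<close> and arbitrary initial law, defined on the probability space \<open>P\<close>.\<close>

definition markov_chain ::
    "'w measure \<Rightarrow> 's set \<Rightarrow> ('s \<Rightarrow> 's \<Rightarrow> real) \<Rightarrow> (nat \<Rightarrow> 'w \<Rightarrow> 's) \<Rightarrow> bool" where
  "markov_chain P S p X \<longleftrightarrow>
     prob_space P \<and>
     countable S \<and>
     (\<forall>t. X t \<in> measurable P (count_space S)) \<and>
     (\<forall>t x y. (\<forall>i\<le>t. x i \<in> S) \<longrightarrow> y \<in> S \<longrightarrow>
        \<P>(\<omega> in P. \<forall>i\<le>t. X i \<omega> = x i) > 0 \<longrightarrow>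
        \<P>(\<omega> in P. X (Suc t) \<omega> = y \<bar> \<forall>i\<le>t. X i \<omega> = x i) = p (x t) y)"

text \<open>Tuples in \<open>{1..n}^M\<close> are extensional functions on \<open>{1..M}\<close>: ball \<open>i\<close> lies in urn \<open>x i\<close>.\<close>

definition configs :: "nat \<Rightarrow> nat \<Rightarrow> (nat \<Rightarrow> nat) set" where
  "configs n M = {1..M} \<rightarrow>\<^sub>E {1..n}"

definition const_config :: "nat \<Rightarrow> nat \<Rightarrow> nat \<Rightarrow> nat" where
  "const_config M j = (\<lambda>i\<in>{1..M}. j)"

definition ehrenfest_prob :: "nat \<Rightarrow> nat \<Rightarrow> (nat \<Rightarrow> nat) \<Rightarrow> (nat \<Rightarrow> nat) \<Rightarrow> real" where
  "ehrenfest_prob n M x y =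
     (if card {i \<in> {1..M}. x i \<noteq> y i} = 1 then 1 / ((real n - 1) * real M) else 0)"

definition ehrenfest_chain ::
    "nat \<Rightarrow> nat \<Rightarrow> 'w measure \<Rightarrow> (nat \<Rightarrow> 'w \<Rightarrow> nat \<Rightarrow> nat) \<Rightarrow> bool" where
  "ehrenfest_chain n M P X \<longleftrightarrow> markov_chain P (configs n M) (ehrenfest_prob n M) X"

text \<open>The infimum is taken in \<open>enat\<close>, so it is \<open>\<infinity>\<close> if \<open>x\<close> is never reached.\<close>

definition hitting_time :: "(nat \<Rightarrow> 'w \<Rightarrow> 's) \<Rightarrow> 's \<Rightarrow> 'w \<Rightarrow> enat" where
  "hitting_time X x \<omega> = (INF t\<in>{t. X t \<omega> = x}. enat t)"

text \<open>Expectation of a \<open>[0,\<infinity>]\<close>-valued variable under \<open>P\<close> conditioned on the event \<open>A\<close>;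
  meaningful only when \<open>A\<close> has positive probability.\<close>

definition cond_expect_event :: "'w measure \<Rightarrow> ('w \<Rightarrow> ennreal) \<Rightarrow> 'w set \<Rightarrow> ennreal" where
  "cond_expect_event P f A = (\<integral>\<^sup>+ \<omega>. f \<omega> \<partial>uniform_measure P A)"

end

theory Submission
  imports Defs
begin

text \<open>The number of balls outside the target urn is itself a birth-and-death chain, so the expected
  hitting time is a function \<open>h\<close> of this number. With \<open>q = n - 1\<close>, the one-step equation for \<open>h\<close> is a
  first-order recursion for the increments \<open>h d - h (d - 1)\<close>, solved by
  \<open>M / (d * (M choose d))\<close> times the tail \<open>\<Sum>j\<ge>d. q ^ (j - d + 1) * (M choose j)\<close>. Summed over \<open>d\<close>,
  these increments (divided by \<open>M\<close>) telescope in the difference between \<open>M\<close> and \<open>M - 1\<close>, leaving the single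
  term \<open>q * n ^ (M - 1) / M\<close>. That the solution \<open>h\<close> of the one-step equation equals the expected
  hitting time follows from the martingale argument of Dynkin's formula.\<close>

section \<open>Binomial tails and the increments of the expected hitting time\<close>

text \<open>Closed form: \<open>binomial_tail q N d = (\<Sum>j=d..N. q ^ (j + 1 - d) * real (N choose j))\<close>.\<close>

fun binomial_tail :: "real \<Rightarrow> nat \<Rightarrow> nat \<Rightarrow> real" where
  "binomial_tail q 0 0 = q"
| "binomial_tail q 0 (Suc d) = 0"
| "binomial_tail q (Suc N) 0 = (q + 1) * binomial_tail q N 0"
| "binomial_tail q (Suc N) (Suc d) = binomial_tail q N (Suc d) + binomial_tail q N d"

text \<open>The term \<open>j = d\<close> of the tail is split off. The recursive definition encodes
  Pascal's rule, so induction on \<open>N\<close> suffices.\<close>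

lemma binomial_tail_rec:
  "binomial_tail q N d = q * real (N choose d) + q * binomial_tail q N (Suc d)"
proof (induction N arbitrary: d)
  case 0
  show ?case by (cases d) auto
next
  case (Suc N)
  show ?case
  proof (cases d)
    case 0
    then show ?thesis using Suc.IH[of 0] by (simp add: algebra_simps)
  next
    case (Suc d')
    then show ?thesis
      using Suc.IH[of d'] Suc.IH[of "Suc d'"] by (simp add: algebra_simps)
  qed
qed

lemma binomial_tail_0: "binomial_tail q N 0 = q * (q + 1) ^ N"
  by (induction N) auto

lemma binomial_tail_eq_0: "N < d \<Longrightarrow> binomial_tail q N d = 0"
proof (induction N arbitrary: d)
  case 0
  then show ?case by (cases d) auto
next
  case (Suc N)
  then show ?case by (cases d) auto
qed

lemma binomial_tail_nonneg: "q \<ge> 0 \<Longrightarrow> binomial_tail q N d \<ge> 0"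
  by (induction q N d rule: binomial_tail.induct) auto

text \<open>Both sides equal \<open>M * (M - 1 choose d)\<close>. This rewrites the denominator of
  \<open>hit_incr\<close> at \<open>Suc d\<close> in terms of \<open>M choose d\<close>.\<close>

lemma binomial_Suc_ratio:
  assumes "d \<le> M"
  shows "real (Suc d) * real (M choose Suc d) = real (M choose d) * (real M - real d)"
proof -
  have "Suc d * (M choose Suc d) = (M choose d) * (M - d)"
    using binomial_absorption[of d M] binomial_absorb_comp[of M d] by (simp only: mult.commute)
  then show ?thesis
    using assms by (metis of_nat_diff of_nat_mult)
qed

text \<open>The rule of the Leibniz harmonic triangle: an entry is the sum of the two below it. Once
  all binomials are expressed through \<open>N choose (d - 1)\<close>, it is an identity of
  fractions.\<close>

lemma inverse_binomial_pascal:
  assumes "1 \<le> d" "d \<le> N"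
  shows "1 / (real d * real (N choose d))
    = 1 / (real d * real (Suc N choose d)) + 1 / (real (Suc d) * real (Suc N choose Suc d))"
proof -
  obtain e where d: "d = Suc e" using assms by (cases d) auto
  have 1: "real (Suc e) * real (Suc N choose Suc e) = real (Suc N) * real (N choose e)" for e
    using Suc_times_binomial[of e N] by (metis of_nat_mult)
  have 2: "real (Suc e) * real (N choose Suc e) = real (N choose e) * (real N - real e)"
    using assms d by (intro binomial_Suc_ratio) simp
  have pos: "real (N choose e) > 0" "real (N choose Suc e) > 0" "real N - real e > 0"
    using assms d by auto
  have 3: "real (N choose Suc e) = real (N choose e) * (real N - real e) / real (Suc e)"
    using 2 by (simp add: field_simps)
  show ?thesis
    unfolding d 1 2 3 using pos
    by (simp add: divide_simps)
qed

text \<open>The expected time to decrease the distance from \<open>d\<close> to \<open>d - 1\<close>, divided by \<open>M\<close>.\<close>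

definition hit_incr :: "real \<Rightarrow> nat \<Rightarrow> nat \<Rightarrow> real" where
  "hit_incr q M d = binomial_tail q M d / (real d * real (M choose d))"

text \<open>This is the one-step equation in terms of increments: the weights of a step down and a
  step up are \<open>d\<close> and \<open>q * (M - d)\<close>. It is
  \<open>binomial_tail_rec\<close> divided by \<open>M choose d\<close>.\<close>

lemma hit_incr_rec:
  assumes "1 \<le> d" "d \<le> M"
  shows "real d * hit_incr q M d = q + q * (real M - real d) * hit_incr q M (Suc d)"
proof (cases "d = M")
  \<comment> \<open>At \<open>d = M\<close> the ratio rule would divide by \<open>M - d = 0\<close>;
    here the tail beyond \<open>M\<close> is empty.\<close>
  case True
  then show ?thesis
    using assms binomial_tail_rec[of q M M]
    by (simp add: hit_incr_def binomial_tail_eq_0)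
next
  case False
  note 1 = binomial_Suc_ratio[OF assms(2)]
  have pos: "real (M choose d) > 0" "real M - real d > 0"
    using assms False by auto
  show ?thesis
    unfolding hit_incr_def 1 binomial_tail_rec[of q M d] using pos assms
    by (simp add: field_simps)
qed

text \<open>The difference of the left-hand sides for \<open>Suc N\<close> and \<open>N\<close> telescopes with certificate \<open>G\<close>.\<close>

lemma sum_hit_incr:
  "(\<Sum>d=1..M. hit_incr q M d) = (\<Sum>k=1..M. q * (q + 1) ^ (k - 1) / real k)"
proof (induction M)
  case 0
  show ?case by simp
next
  case (Suc N)
  \<comment> \<open>Pascal's rule splits \<open>binomial_tail q (Suc N) d\<close> in two: the
    summand with \<open>d - 1\<close> gives \<open>G d\<close>, and the other one minus
    \<open>hit_incr q N d\<close> gives \<open>- G (Suc d)\<close> by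
    \<open>inverse_binomial_pascal\<close>.\<close>
  define G where "G d = binomial_tail q N (d - 1) / (real d * real (Suc N choose d))" for d
  have step: "hit_incr q (Suc N) d - hit_incr q N d = G d - G (Suc d)" if "d \<in> {1..Suc N}" for d
  proof -
    have "d > 0" using that by simp
    then obtain e where e: "d = Suc e" by (cases d) auto
    show ?thesis
    proof (cases "d \<le> N")
      case True
      have "hit_incr q N d = binomial_tail q N d * (1 / (real d * real (N choose d)))"
        by (simp add: hit_incr_def)
      also have "\<dots> = binomial_tail q N d / (real d * real (Suc N choose d)) + G (Suc d)"
        using that True by (subst inverse_binomial_pascal) (auto simp: G_def distrib_left)
      finally show ?thesis
        by (simp add: e hit_incr_def G_def add_divide_distrib del: binomial_Suc_Suc)
    next
      case False
      then show ?thesis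
        using that by (simp add: e hit_incr_def G_def binomial_tail_eq_0)
    qed
  qed
  have "(\<Sum>d=1..Suc N. hit_incr q (Suc N) d) - (\<Sum>d=1..Suc N. hit_incr q N d)
      = (\<Sum>d=1..Suc N. G d - G (Suc d))"
    unfolding sum_subtractf[symmetric] using step by (intro sum.cong) auto
  also have "\<dots> = G 1 - G (Suc (Suc N))"
    using sum_Suc_diff[of 1 "Suc (Suc N)" "\<lambda>d. - G d"]
    by (simp add: atLeastLessThanSuc_atLeastAtMost[symmetric] sum_Suc_diff' sum_telescope)
  \<comment> \<open>The term \<open>hit_incr q N (Suc N)\<close> and the end value of
    \<open>G\<close> vanish; \<open>G 1\<close> is the new summand \<open>k = Suc N\<close>.\<close>
  finally show ?case
    using Suc.IH by (simp add: G_def binomial_tail_eq_0 binomial_tail_0 hit_incr_def)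
qed

section \<open>Expected hitting times of finite Markov chains\<close>

text \<open>The Markov property is assumed for single histories of positive probability. Summing
  over the finitely many disjoint histories in \<open>H\<close> extends it to events of the past;
  the product form also covers null events.\<close>

lemma markov_chain_history_step:
  assumes mc: "markov_chain P S p X" and "finite S" and H: "H \<subseteq> {..t} \<rightarrow>\<^sub>E S"
    and Hx: "\<And>w. w \<in> H \<Longrightarrow> w t = x" and y: "y \<in> S"
  shows "\<P>(\<omega> in P. (\<lambda>i\<in>{..t}. X i \<omega>) \<in> H \<and> X (Suc t) \<omega> = y)
    = \<P>(\<omega> in P. (\<lambda>i\<in>{..t}. X i \<omega>) \<in> H) * p x y"
proof -
  interpret prob_space P
    using mc by (simp add: markov_chain_def)
  have X[measurable]: "X s \<in> measurable P (count_space S)" for s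
    using mc by (simp add: markov_chain_def)
  have "finite H"
    using H \<open>finite S\<close> finite_subset finite_PiE by (metis finite_atMost)
  define Q where "Q w = {\<omega> \<in> space P. \<forall>i\<le>t. X i \<omega> = w i}" for w
  define Q' where "Q' w = {\<omega> \<in> space P. X (Suc t) \<omega> = y \<and> (\<forall>i\<le>t. X i \<omega> = w i)}" for w
  have Q[measurable]: "Q w \<in> sets P" "Q' w \<in> sets P" for w
    unfolding Q_def Q'_def by measurable
  have path: "prob (Q' w) = prob (Q w) * p x y" if w: "w \<in> H" for w
  proof (cases "prob (Q w) = 0")
    case True
    have "prob (Q' w) \<le> prob (Q w)"
      by (intro finite_measure_mono) (auto simp: Q_def Q'_def)
    then show ?thesis
      using True measure_nonneg[of P "Q' w"] by simp
  next
    case False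
    then have "prob (Q w) > 0"
      by (simp add: zero_less_measure_iff)
    moreover have "\<forall>i\<le>t. w i \<in> S"
      using w H by auto
    ultimately have "\<P>(\<omega> in P. X (Suc t) \<omega> = y \<bar> \<forall>i\<le>t. X i \<omega> = w i) = p (w t) y"
      using mc y unfolding markov_chain_def Q_def by blast
    then show ?thesis
      using False Hx[OF w] by (simp add: cond_prob_def Q_def Q'_def field_simps)
  qed
  have eq: "(\<lambda>i\<in>{..t}. X i \<omega>) = w \<longleftrightarrow> (\<forall>i\<le>t. X i \<omega> = w i)" if "w \<in> H" for w \<omega>
  proof -
    have "w \<in> extensional {..t}"
      using that H by (auto simp: PiE_def)
    then show ?thesis
      by (auto simp: fun_eq_iff extensional_def restrict_def)
  qed
  define R where "R = (\<lambda>\<omega>. \<lambda>i\<in>{..t}. X i \<omega>)"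
  have Q_iff: "\<omega> \<in> Q w \<longleftrightarrow> \<omega> \<in> space P \<and> R \<omega> = w"
    and Q'_iff: "\<omega> \<in> Q' w \<longleftrightarrow> \<omega> \<in> space P \<and> R \<omega> = w \<and> X (Suc t) \<omega> = y" if "w \<in> H" for w \<omega>
    using eq[OF that, of \<omega>] by (auto simp only: Q_def Q'_def R_def mem_Collect_eq)
  have disj: "disjoint_family_on Q H" "disjoint_family_on Q' H"
    by (auto simp: disjoint_family_on_def Q_iff Q'_iff)
  have "{\<omega> \<in> space P. (\<lambda>i\<in>{..t}. X i \<omega>) \<in> H \<and> X (Suc t) \<omega> = y} = (\<Union>w\<in>H. Q' w)"
    unfolding R_def[THEN fun_cong, symmetric] by (auto simp: Q'_iff)
  moreover have "{\<omega> \<in> space P. (\<lambda>i\<in>{..t}. X i \<omega>) \<in> H} = (\<Union>w\<in>H. Q w)"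
    unfolding R_def[THEN fun_cong, symmetric] by (auto simp: Q_iff)
  ultimately show ?thesis
    using \<open>finite H\<close> disj Q path
    by (simp add: finite_measure_finite_Union image_subset_iff sum_distrib_right)
qed

text \<open>The infimum over a random set of times is rewritten as a countable infimum with a fixed
  index set.\<close>

lemma hitting_time_measurable:
  assumes [measurable]: "\<And>t. X t \<in> measurable P (count_space S)"
  shows "hitting_time X b \<in> measurable P (count_space UNIV)"
proof -
  have "hitting_time X b = (\<lambda>\<omega>. INF t. if X t \<omega> = b then enat t else \<infinity>)"
    unfolding hitting_time_def
  proof (intro ext antisym INF_greatest)
    fix \<omega> t
    assume "t \<in> {t. X t \<omega> = b}"
    then show "(INF t. if X t \<omega> = b then enat t else \<infinity>) \<le> enat t"
      by (intro INF_lower2[of t]) auto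
  qed (auto intro: INF_lower)
  also have "\<dots> \<in> measurable P (count_space UNIV)"
    by measurable
  finally show ?thesis .
qed

lemma less_hitting_time_iff: "enat t < hitting_time X b \<omega> \<longleftrightarrow> (\<forall>i\<le>t. X i \<omega> \<noteq> b)"
proof -
  \<comment> \<open>Unlike \<open><\<close>, the relation \<open>\<le>\<close> to an infimum can be
    tested on each member.\<close>
  have "enat (Suc t) \<le> hitting_time X b \<omega> \<longleftrightarrow> (\<forall>i\<le>t. X i \<omega> \<noteq> b)"
    unfolding hitting_time_def le_INF_iff by (auto simp: not_le less_Suc_eq_le Suc_le_eq)
  then show ?thesis
    by (simp add: Suc_ile_eq)
qed

text \<open>Dynkin's formula: \<open>g (X t)\<close> loses on average one unit per step before the hitting time.
  As \<open>g\<close> is bounded and nonnegative, this also forces the hitting time to be almost surely finite.\<close>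

lemma expected_hitting_time_eqI:
  fixes g :: "'s \<Rightarrow> real"
  assumes mc: "markov_chain P S p X" and S: "finite S"
    and g: "\<And>x. x \<in> S \<Longrightarrow> g x \<ge> 0" "g b = 0"
    and harm: "\<And>x. x \<in> S \<Longrightarrow> x \<noteq> b \<Longrightarrow> (\<Sum>y\<in>S. p x y * g y) = g x - 1"
    and a: "\<P>(\<omega> in P. X 0 \<omega> = a) > 0"
  shows "cond_expect_event P (\<lambda>\<omega>. ennreal_of_enat (hitting_time X b \<omega>))
    {\<omega> \<in> space P. X 0 \<omega> = a} = ennreal (g a)"
proof -
  interpret prob_space P
    using mc by (simp add: markov_chain_def)
  have X[measurable]: "X s \<in> measurable P (count_space S)" for s
    using mc by (simp add: markov_chain_def)
  have XS: "X s \<omega> \<in> S" if "\<omega> \<in> space P" for s \<omega>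
    using measurable_space[OF X that] by simp
  define A where "A = {\<omega> \<in> space P. X 0 \<omega> = a}"
  have A[measurable]: "A \<in> sets P"
    unfolding A_def by measurable
  define L where "L t = {\<omega> \<in> A. \<forall>i\<le>t. X i \<omega> \<noteq> b}" for t
  have L[measurable]: "L t \<in> sets P" for t
    unfolding L_def A_def by measurable
  have LS: "L t \<subseteq> space P" for t
    by (auto simp: L_def A_def)
  define E where "E t x = L t \<inter> {\<omega> \<in> space P. X t \<omega> = x}" for t x
  define E' where "E' t x y = E t x \<inter> {\<omega> \<in> space P. X (Suc t) \<omega> = y}" for t x y
  have E[measurable]: "E t x \<in> sets P" "E' t x y \<in> sets P" for t x y
    unfolding E_def E'_def by measurable
  \<comment> \<open>As \<open>g b = 0\<close>, \<open>m t\<close> is the expectation over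
    \<open>A\<close> of \<open>g\<close> along the chain stopped at \<open>b\<close>.\<close>
  define m where "m t = (\<Sum>x\<in>S. prob (E t x) * g x)" for t
  have E'_prob: "prob (E' t x y) = prob (E t x) * p x y" if "y \<in> S" for t x y
  proof -
    define H where "H = {w \<in> {..t} \<rightarrow>\<^sub>E S. w 0 = a \<and> (\<forall>i\<le>t. w i \<noteq> b) \<and> w t = x}"
    have H: "(\<lambda>i\<in>{..t}. X i \<omega>) \<in> H \<longleftrightarrow> \<omega> \<in> E t x" if "\<omega> \<in> space P" for \<omega>
    proof -
      have "(\<lambda>i\<in>{..t}. X i \<omega>) \<in> {..t} \<rightarrow>\<^sub>E S"
        by (intro restrict_PiE_iff[THEN iffD2] ballI XS that)
      moreover have "(\<forall>i\<le>t. (\<lambda>i\<in>{..t}. X i \<omega>) i \<noteq> b) \<longleftrightarrow> (\<forall>i\<le>t. X i \<omega> \<noteq> b)"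
        by simp
      ultimately show ?thesis
        using that by (simp add: H_def E_def L_def A_def conj_comms)
    qed
    have "{\<omega> \<in> space P. (\<lambda>i\<in>{..t}. X i \<omega>) \<in> H} = E t x"
      "{\<omega> \<in> space P. (\<lambda>i\<in>{..t}. X i \<omega>) \<in> H \<and> X (Suc t) \<omega> = y} = E' t x y"
      using H LS by (auto simp: E'_def E_def)
    moreover have "H \<subseteq> {..t} \<rightarrow>\<^sub>E S" "\<And>w. w \<in> H \<Longrightarrow> w t = x"
      by (simp_all add: H_def subset_iff)
    ultimately show ?thesis
      using markov_chain_history_step[OF mc S, of H t x y] that by (simp only:)
  qed
  have E'_sum: "(\<Sum>x\<in>S. prob (E' t x y)) = prob (L t \<inter> {\<omega> \<in> space P. X (Suc t) \<omega> = y})" for t y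
  proof -
    have "L t \<inter> {\<omega> \<in> space P. X (Suc t) \<omega> = y} = (\<Union>x\<in>S. E' t x y)"
      using XS by (auto simp: E'_def E_def)
    moreover have "disjoint_family_on (\<lambda>x. E' t x y) S"
      by (auto simp: disjoint_family_on_def E'_def E_def)
    ultimately show ?thesis
      using S by (simp add: finite_measure_finite_Union image_subset_iff)
  qed
  have E_sum: "(\<Sum>x\<in>S. prob (E t x)) = prob (L t)" for t
  proof -
    have "L t = (\<Union>x\<in>S. E t x)"
      using XS LS[of t] by (auto simp: E_def)
    moreover have "disjoint_family_on (E t) S"
      by (auto simp: disjoint_family_on_def E_def)
    ultimately show ?thesis
      using S by (simp add: finite_measure_finite_Union image_subset_iff)
  qed
  have E_b: "E t b = {}" for t
    by (auto simp: E_def L_def)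
  have step: "m (Suc t) = m t - prob (L t)" for t
  proof -
    \<comment> \<open>Paths that enter \<open>b\<close> at time \<open>Suc t\<close> leave
      \<open>L\<close>, but they carry weight \<open>g b = 0\<close>.\<close>
    have "prob (E (Suc t) y) * g y = (\<Sum>x\<in>S. prob (E' t x y)) * g y" for y
    proof (cases "y = b")
      case False
      then have "E (Suc t) y = L t \<inter> {\<omega> \<in> space P. X (Suc t) \<omega> = y}"
        by (auto simp: E_def L_def le_Suc_eq)
      then show ?thesis by (simp add: E'_sum)
    qed (simp add: g)
    then have "m (Suc t) = (\<Sum>y\<in>S. \<Sum>x\<in>S. prob (E t x) * p x y * g y)"
      by (simp add: m_def sum_distrib_right E'_prob)
    also have "\<dots> = (\<Sum>x\<in>S. prob (E t x) * (\<Sum>y\<in>S. p x y * g y))"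
      by (subst sum.swap) (simp add: sum_distrib_left mult.assoc)
    also have "\<dots> = (\<Sum>x\<in>S. prob (E t x) * (g x - 1))"
      by (intro sum.cong refl) (metis E_b harm measure_empty mult_zero_left)
    also have "\<dots> = m t - prob (L t)"
      by (simp add: m_def right_diff_distrib sum_subtractf E_sum)
    finally show ?thesis .
  qed
  obtain \<omega>0 where "\<omega>0 \<in> A"
    using a unfolding A_def by (metis (mono_tags, lifting) Collect_empty_eq mem_Collect_eq measure_empty less_irrefl)
  then have aS: "a \<in> S"
    using XS by (auto simp: A_def)
  have m_0: "m 0 = prob A * g a"
  proof -
    have "prob (E 0 x) * g x = (if x = a then prob A * g a else 0)" for x
    proof (cases "x = b")
      case False
      then have "E 0 x = (if x = a then A else {})"
        by (auto simp: E_def L_def A_def)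
      then show ?thesis by simp
    qed (use g in auto)
    then show ?thesis
      using S aS by (simp add: m_def)
  qed
  have partial: "(\<Sum>t<k. prob (L t)) = m 0 - m k" for k
    by (induction k) (simp_all add: step)
  have m_nonneg: "m t \<ge> 0" for t
    using g by (auto simp: m_def intro!: sum_nonneg)
  have summable: "summable (\<lambda>t. prob (L t))"
    by (rule bounded_imp_summable[of _ "m 0"])
       (use partial[of "Suc _"] m_nonneg in \<open>auto simp: lessThan_Suc_atMost\<close>)
  \<comment> \<open>\<open>m t\<close> is at most a constant times \<open>prob (L t)\<close>, which
    tends to 0 because its series converges.\<close>
  have m_lim: "m \<longlonglongrightarrow> 0"
  proof (rule tendsto_sandwich[of "\<lambda>_. 0"])
    show "\<forall>\<^sub>F t in sequentially. m t \<le> (\<Sum>x\<in>S. prob (L t) * g x)"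
      using g by (auto simp: m_def E_def intro!: always_eventually sum_mono mult_right_mono finite_measure_mono)
    show "(\<lambda>t. \<Sum>x\<in>S. prob (L t) * g x) \<longlonglongrightarrow> 0"
      using summable_LIMSEQ_zero[OF summable] by (auto intro!: tendsto_null_sum tendsto_mult_left_zero)
  qed (use m_nonneg in auto)
  have "(\<lambda>k. \<Sum>t<k. prob (L t)) \<longlonglongrightarrow> m 0 - 0"
    unfolding partial by (intro tendsto_intros m_lim)
  then have sums: "(\<lambda>t. prob (L t)) sums (prob A * g a)"
    by (simp add: sums_def m_0)
  have A_pos: "prob A > 0"
    using a by (simp add: A_def)
  \<comment> \<open>Tail-sum formula: the expectation of the hitting time is the sum over
    \<open>t\<close> of the probabilities that it exceeds \<open>t\<close>.\<close>
  have "cond_expect_event P (\<lambda>\<omega>. ennreal_of_enat (hitting_time X b \<omega>)) A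
      = (\<Sum>t. emeasure (uniform_measure P A) {\<omega> \<in> space P. enat t < hitting_time X b \<omega>})"
    unfolding cond_expect_event_def
    by (subst nn_integral_enat_function) (simp_all add: hitting_time_measurable[OF X] measurable_cong_sets[OF sets_uniform_measure refl])
  also have "\<dots> = (\<Sum>t. ennreal (prob (L t) / prob A))"
  proof (intro suminf_cong)
    fix t
    have "{\<omega> \<in> space P. enat t < hitting_time X b \<omega>} \<in> sets P"
      unfolding less_hitting_time_iff by measurable
    moreover have "A \<inter> {\<omega> \<in> space P. enat t < hitting_time X b \<omega>} = L t"
      by (auto simp: L_def A_def less_hitting_time_iff)
    ultimately show "emeasure (uniform_measure P A) {\<omega> \<in> space P. enat t < hitting_time X b \<omega>}
        = ennreal (prob (L t) / prob A)"
      using A_pos by (simp add: emeasure_eq_measure divide_ennreal)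
  qed
  also have "\<dots> = ennreal (g a)"
  proof (rule suminf_ennreal_eq)
    have "prob A * g a / prob A = g a"
      using A_pos by simp
    then show "(\<lambda>t. prob (L t) / prob A) sums g a"
      using sums_divide[OF sums, of "prob A"] by (simp only:)
  qed simp
  finally show ?thesis
    by (simp only: A_def)
qed

section \<open>Averages over one step of the Ehrenfest chain\<close>

text \<open>The neighbours of \<open>x\<close> correspond bijectively to pairs of a ball
  \<open>i\<close> and a new urn \<open>j \<noteq> x i\<close>, all with the same transition
  probability.\<close>

lemma sum_ehrenfest_prob:
  fixes g :: "(nat \<Rightarrow> nat) \<Rightarrow> real"
  assumes x: "x \<in> configs n M"
  shows "(\<Sum>y\<in>configs n M. ehrenfest_prob n M x y * g y)
    = (\<Sum>i\<in>{1..M}. \<Sum>j\<in>{1..n} - {x i}. g (x(i := j))) / ((real n - 1) * real M)"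
proof -
  let ?N = "{y \<in> configs n M. card {i \<in> {1..M}. x i \<noteq> y i} = 1}"
  let ?I = "Sigma {1..M} (\<lambda>i. {1..n} - {x i})"
  have fin: "finite (configs n M)"
    by (simp add: configs_def finite_PiE)
  have bij: "bij_betw (\<lambda>(i, j). x(i := j)) ?I ?N"
  proof (rule bij_betw_imageI)
    show "inj_on (\<lambda>(i, j). x(i := j)) ?I"
      by (auto simp: inj_on_def split: if_splits) (metis fun_upd_apply)+
    show "(\<lambda>(i, j). x(i := j)) ` ?I = ?N"
    proof (intro subset_antisym subsetI)
      fix y assume "y \<in> (\<lambda>(i, j). x(i := j)) ` ?I"
      then obtain i j where ij: "i \<in> {1..M}" "j \<in> {1..n}" "j \<noteq> x i" "y = x(i := j)"
        by (elim imageE SigmaE) (metis (no_types, lifting) Diff_iff case_prod_conv singletonI)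
      then have "{k \<in> {1..M}. x k \<noteq> y k} = {i}"
        by auto
      then show "y \<in> ?N"
        using ij x by (auto simp: configs_def PiE_iff extensional_def)
    next
      fix y assume y: "y \<in> ?N"
      then obtain i where i: "{k \<in> {1..M}. x k \<noteq> y k} = {i}"
        by (auto simp: card_1_singleton_iff)
      then have *: "i \<in> {1..M}" "x i \<noteq> y i" "\<And>k. k \<in> {1..M} \<Longrightarrow> k \<noteq> i \<Longrightarrow> x k = y k"
        by blast+
      have "y = x(i := y i)"
      proof
        fix k show "y k = (x(i := y i)) k"
          using * x y by (cases "k \<in> {1..M}") (auto simp: configs_def PiE_iff extensional_def)
      qed
      moreover have "(i, y i) \<in> ?I"
        using * y by (auto simp: configs_def PiE_iff)
      ultimately show "y \<in> (\<lambda>(i, j). x(i := j)) ` ?I"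
        by (metis (mono_tags, lifting) case_prod_conv image_eqI)
    qed
  qed
  have "(\<Sum>y\<in>configs n M. ehrenfest_prob n M x y * g y) = (\<Sum>y\<in>?N. g y / ((real n - 1) * real M))"
    using fin by (intro sum.mono_neutral_cong_right) (auto simp: ehrenfest_prob_def)
  also have "\<dots> = (\<Sum>(i, j)\<in>?I. g (x(i := j))) / ((real n - 1) * real M)"
    using sum.reindex_bij_betw[OF bij, of g]
    by (simp add: sum_divide_distrib[symmetric] case_prod_unfold)
  also have "(\<Sum>(i, j)\<in>?I. g (x(i := j))) = (\<Sum>i\<in>{1..M}. \<Sum>j\<in>{1..n} - {x i}. g (x(i := j)))"
    by (subst sum.Sigma) auto
  finally show ?thesis .
qed

text \<open>The Hamming distance to \<open>const_config M c\<close>.\<close>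

definition distance_from_const :: "nat \<Rightarrow> nat \<Rightarrow> (nat \<Rightarrow> nat) \<Rightarrow> nat" where
  "distance_from_const M c x = card {i \<in> {1..M}. x i \<noteq> c}"

text \<open>Ball \<open>i\<close> is first removed, then put back. The subtraction never truncates:
  if \<open>x i \<noteq> c\<close>, ball \<open>i\<close> itself is counted.\<close>

lemma distance_from_const_upd:
  assumes "i \<in> {1..M}"
  shows "distance_from_const M c (x(i := j))
    = (if j = c then 0 else 1) + (distance_from_const M c x - (if x i = c then 0 else 1))"
proof -
  let ?D = "{k \<in> {1..M}. x k \<noteq> c}"
  have "finite ?D"
    by simp
  have "{k \<in> {1..M}. (x(i := j)) k \<noteq> c} = (if j = c then ?D - {i} else insert i (?D - {i}))"
    using assms by auto
  then have "distance_from_const M c (x(i := j)) = (if j = c then 0 else 1) + card (?D - {i})"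
    by (simp only: distance_from_const_def) (simp add: card_insert_disjoint del: card_Diff_insert insert_Diff_single)
  also have "card (?D - {i}) = card ?D - (if x i = c then 0 else 1)"
    using assms by (simp add: card_Diff_singleton_if)
  finally show ?thesis
    by (simp only: distance_from_const_def)
qed

text \<open>Each of the \<open>M - d\<close> balls in urn \<open>c\<close> can only move away from
  it; each of the \<open>d\<close> others has one move into \<open>c\<close> and
  \<open>n - 2\<close> moves that keep the distance. At \<open>d = 0\<close> the term
  \<open>h (d - 1)\<close> has weight 0.\<close>

lemma sum_ehrenfest_prob_distance:
  fixes h :: "nat \<Rightarrow> real"
  assumes "n \<ge> 2" "c \<in> {1..n}" and x: "x \<in> configs n M" and d: "d = distance_from_const M c x"
  shows "(\<Sum>y\<in>configs n M. ehrenfest_prob n M x y * h (distance_from_const M c y))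
    = ((real M - real d) * (real n - 1) * h (Suc d) + real d * h (d - 1)
        + real d * (real n - 2) * h d) / ((real n - 1) * real M)"
proof -
  let ?D = "{i \<in> {1..M}. x i \<noteq> c}" and ?F = "{i \<in> {1..M}. x i = c}"
  let ?s = "\<lambda>i. \<Sum>j\<in>{1..n} - {x i}. h (distance_from_const M c (x(i := j)))"
  have card_D: "card ?D = d"
    by (simp add: d distance_from_const_def)
  have "card ?D + card ?F = card (?D \<union> ?F)"
    by (intro card_Un_disjoint[symmetric]) auto
  also have "?D \<union> ?F = {1..M}"
    by auto
  finally have card_F: "real (card ?F) = real M - real d"
    using card_D by simp
  have xi: "x i \<in> {1..n}" if "i \<in> {1..M}" for i
    using x that by (auto simp: configs_def PiE_iff)
  have F: "?s i = (real n - 1) * h (Suc d)" if "i \<in> ?F" for i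
  proof -
    have "?s i = (\<Sum>j\<in>{1..n} - {x i}. h (Suc d))"
      using that by (intro sum.cong) (auto simp: distance_from_const_upd d)
    then show ?thesis
      using xi[of i] that assms(1) by (simp add: card_Diff_singleton_if of_nat_diff)
  qed
  have D: "?s i = h (d - 1) + (real n - 2) * h d" if "i \<in> ?D" for i
  proof -
    have "d > 0"
      unfolding card_D[symmetric] using that by (subst card_gt_0_iff) auto
    have card: "card ({1..n} - {x i, c}) = n - 2"
      using that xi[of i] assms(2) by (subst card_Diff_subset) auto
    have "{1..n} - {x i} = insert c ({1..n} - {x i, c})"
      using that assms(2) by auto
    then have "?s i = h (distance_from_const M c (x(i := c)))
        + (\<Sum>j\<in>{1..n} - {x i, c}. h (distance_from_const M c (x(i := j))))"
      by simp
    also have "(\<Sum>j\<in>{1..n} - {x i, c}. h (distance_from_const M c (x(i := j))))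
        = (\<Sum>j\<in>{1..n} - {x i, c}. h d)"
      using that \<open>d > 0\<close> by (intro sum.cong) (auto simp: distance_from_const_upd d)
    also have "\<dots> = real (n - 2) * h d"
      using card that by simp
    also have "h (distance_from_const M c (x(i := c))) = h (d - 1)"
      using that by (simp add: distance_from_const_upd d)
    finally show ?thesis
      using assms(1) by (simp del: fun_upd_apply)
  qed
  have "sum ?s {1..M} = sum ?s (?F \<union> ?D)"
    by (intro sum.cong) auto
  also have "\<dots> = sum ?s ?F + sum ?s ?D"
    by (intro sum.union_disjoint) auto
  also have "sum ?s ?F = (\<Sum>i\<in>?F. (real n - 1) * h (Suc d))"
    by (intro sum.cong refl F)
  also have "sum ?s ?D = (\<Sum>i\<in>?D. h (d - 1) + (real n - 2) * h d)"
    by (intro sum.cong refl D)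
  finally have "sum ?s {1..M} = (real M - real d) * ((real n - 1) * h (Suc d))
      + real d * (h (d - 1) + (real n - 2) * h d)"
    by (simp only: sum_constant card_D card_F)
  then show ?thesis
    unfolding sum_ehrenfest_prob[OF x] by (simp only: distrib_left mult.assoc add.assoc)
qed

section \<open>The one-step equation and the closed form\<close>

theorem corollary1p2:
  fixes n M :: nat
    and P :: "'w measure"
    and X :: "nat \<Rightarrow> 'w \<Rightarrow> nat \<Rightarrow> nat"
  assumes "n \<ge> 2" and "M \<ge> 1"
    and "ehrenfest_chain n M P X"
    and "\<P>(\<omega> in P. X 0 \<omega> = const_config M 1) > 0"
  shows "cond_expect_event P
           (\<lambda>\<omega>. ennreal_of_enat (hitting_time X (const_config M 2) \<omega>))
           {\<omega> \<in> space P. X 0 \<omega> = const_config M 1}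
         = ennreal ((real n - 1) * real M / real n * (\<Sum>k=1..M. real n ^ k / real k))"
proof -
  define q where "q = real n - 1"
  have q: "q > 0" "real n = q + 1"
    using assms(1) by (auto simp: q_def)
  define h where "h d = real M * (\<Sum>e=1..d. hit_incr q M e)" for d
  define g where "g = (\<lambda>x. h (distance_from_const M 2 x))"
  have h_Suc: "h (Suc d) = h d + real M * hit_incr q M (Suc d)" for d
    by (simp add: h_def algebra_simps)
  have one_step: "(\<Sum>y\<in>configs n M. ehrenfest_prob n M x y * g y) = g x - 1"
    if x: "x \<in> configs n M" "x \<noteq> const_config M 2" for x
  proof -
    define d where "d = distance_from_const M 2 x"
    have "\<exists>i\<in>{1..M}. x i \<noteq> 2"
    proof (rule ccontr)
      assume "\<not> ?thesis"
      then have "x = const_config M 2"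
        using x(1) by (auto simp: const_config_def configs_def PiE_iff extensional_def fun_eq_iff)
      with x(2) show False by simp
    qed
    then have "d \<noteq> 0"
      by (auto simp: d_def distance_from_const_def)
    then obtain e where e: "d = Suc e"
      by (cases d) auto
    have "d \<le> M"
      unfolding d_def distance_from_const_def by (rule order.trans[OF card_mono[of "{1..M}"]]) auto
    then have rec: "real d * hit_incr q M d = q + q * (real M - real d) * hit_incr q M (Suc d)"
      by (intro hit_incr_rec) (simp_all add: e)
    have "(\<Sum>y\<in>configs n M. ehrenfest_prob n M x y * g y)
        = ((real M - real d) * q * h (Suc d) + real d * h (d - 1) + real d * (q - 1) * h d) / (q * real M)"
      unfolding g_def using assms(1) x(1)
      by (subst sum_ehrenfest_prob_distance[OF _ _ _ d_def]) (auto simp: q_def)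
    also have "h (Suc d) = h d + real M * hit_incr q M (Suc d)"
      by (rule h_Suc)
    also have "h (d - 1) = h d - real M * hit_incr q M d"
      by (simp add: e h_Suc)
    \<comment> \<open>The weights of \<open>h d\<close> add up to
      \<open>(M - d) * q + d + d * (q - 1) = M * q\<close>; by \<open>rec\<close>, the remaining
      bracket is \<open>- q\<close>.\<close>
    also have "(real M - real d) * q * (h d + real M * hit_incr q M (Suc d))
          + real d * (h d - real M * hit_incr q M d) + real d * (q - 1) * h d
        = real M * q * h d + real M * (q * (real M - real d) * hit_incr q M (Suc d) - real d * hit_incr q M d)"
      by (simp add: algebra_simps)
    also have "\<dots> = q * real M * (h d - 1)"
      unfolding rec by (simp add: algebra_simps)
    finally show ?thesis
      using q assms(2) by (simp add: g_def d_def)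
  qed
  have "{i \<in> {1..M}. const_config M 1 i \<noteq> 2} = {1..M}" "{i \<in> {1..M}. const_config M 2 i \<noteq> 2} = {}"
    by (auto simp: const_config_def)
  then have dist: "distance_from_const M 2 (const_config M 1) = M"
    "distance_from_const M 2 (const_config M 2) = 0"
    by (simp_all only: distance_from_const_def) simp_all
  have "h d \<ge> 0" for d
    using q unfolding h_def hit_incr_def
    by (intro mult_nonneg_nonneg sum_nonneg divide_nonneg_nonneg binomial_tail_nonneg) auto
  then have "cond_expect_event P
      (\<lambda>\<omega>. ennreal_of_enat (hitting_time X (const_config M 2) \<omega>))
      {\<omega> \<in> space P. X 0 \<omega> = const_config M 1} = ennreal (g (const_config M 1))"
    using assms(3,4) one_step unfolding ehrenfest_chain_def
    by (intro expected_hitting_time_eqI[of P "configs n M" "ehrenfest_prob n M"])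
       (simp_all add: g_def dist(2) configs_def finite_PiE, simp add: h_def)
  also have "g (const_config M 1) = real M * (\<Sum>k=1..M. q * (q + 1) ^ (k - 1) / real k)"
    unfolding g_def dist(1) h_def sum_hit_incr ..
  also have "\<dots> = real M * (\<Sum>k=1..M. q / real n * (real n ^ k / real k))"
    using assms(1) q by (intro arg_cong2[where f="(*)"] sum.cong refl) (auto simp: power_diff)
  also have "\<dots> = q * real M / real n * (\<Sum>k=1..M. real n ^ k / real k)"
    by (simp add: sum_distrib_left mult_ac)
  finally show ?thesis
    by (simp add: q_def)
qed

end
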